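(* Let $\mathcal{R}$ be an RGF class. Then there exists a positive integer $k$ with $\mathcal{R} \subseteq \mathcal{SB}_V(k)$ if and only if, for each of the nine grid classes $\mathcal{X} \in \{\mathcal{G}_{I,I}, \mathcal{G}_{I,C}, \mathcal{G}_{I,D}, \mathcal{G}_{D,I}, \mathcal{G}_{D,C}, \mathcal{G}_{D,D}, \mathcal{V}_{C,I}, \mathcal{V}_{C,C}, \mathcal{V}_{C,D}\}$, there exists a Cayley permutation $\sigma \in \mathcal{X}$ such that $\mathcal{R}$ avoids $\sigma$ (i.e. every RGF in $\mathcal{R}$ avoids $\sigma$).
   Context: A Cayley permutation is a finite word $\pi = \pi_1\pi_2\cdots\pi_n$ of positive integers in which every value between $1$ and the maximum value of $\pi$ appears at least once; its size is $n$. A restricted growth function (RGF) is a Cayley permutation in which, for every value $v$ occurring and every $1 \le u < v$, the first occurrence of $u$ is to the left of the first occurrence of $v$. The standardisation of a word of positive integers is the Cayley permutation obtained by replacing all occurrences of the smallest value by $1$, of the next smallest value by $2$, and so on. A Cayley permutation $\pi$ contains a Cayley permutation $\sigma$ if some (not necessarily contiguous) subsequence of $\pi$ standardises to $\sigma$; otherwise $\pi$ avoids $\sigma$. For a set $\Pi$ of Cayley permutations, $\mathcal{R}(\Pi)$ is the set of all RGFs that avoid every element of $\Pi$; an RGF class is a set of the form $\mathcal{R}(\Pi)$. Vertical evolution: a Cayley permutation $\pi$ of size $N$ is built by inserting its entries in order of increasing value and, among equal values, from left to right. For $0 \le t \le N$ the configuration after $t$ insertions is the word obtained from $\pi$ by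 keeping the $t$ entries inserted so far and replacing each maximal contiguous run of not-yet-inserted entries by a single slot $\diamond$. The vertical evolution of $\pi$ is the sequence of these configurations. $\mathcal{SB}_V(k)$ is the set of all RGFs such that every configuration in their vertical evolution has at most $k$ slots. Grid classes: let $M$ be a matrix with $t$ columns and $u$ rows and entries in $\{I, D, C, 0\}$, where $M_{k,l}$ is the entry in the $k$th column from the left and the $l$th row from the bottom. For a Cayley permutation $\pi$ of size $n$ with maximum value $m$, $\pi[A\times B]$ denotes the subsequence of entries of $\pi$ with index in $A$ and value in $B$. An $M$-gridding of $\pi$ is a pair of integer sequences $1 = c_1 \le c_2 \le \dots \le c_{t+1} = n+1$ and $1 = r_1 \le r_2 \le \dots \le r_{u+1} = m+1$ such that for all $k\in\{1,\dots,t\}$, $l\in\{1,\dots,u\}$ the sequence $\pi[[c_k,c_{k+1})\times[r_l,r_{l+1})]$ is strictly increasing if $M_{k,l}=I$, strictly decreasing if $M_{k,l}=D$, constant if $M_{k,l}=C$, and empty if $M_{k,l}=0$ (the empty sequence counts as increasing, decreasing and constant). The grid class of $M$ is the set of all Cayley permutations having an $M$-gridding (these are said to be griddable on the class). For $A\in\{I,D\}$ and $B\in\{I,D,C\}$, $\mathcal{G}_{A,B}$ is the grid class of $\begin{pmatrix} 0 & B\\ I & A\end{pmatrix}$ (bottom-left entry $I$, bottom-right $A$, top-left $0$, top-right $B$). For $B\in\{I,D,C\}$, $\mathcal{V}_{C,B}$ is the grid class of the one-column matrix $\begin{pmatrix} B\\ C\end{pmatrix}$ (bottom entry $C$, top entry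 $B$). *)

theory Defs
  imports Main "HOL-Library.Sublist"
begin

section \<open>Cayley permutations and restricted growth functions\<close>

definition max_value :: "nat list \<Rightarrow> nat" where
  "max_value w = Max (insert 0 (set w))"

text \<open>The empty word is a Cayley permutation, with maximum value 0.\<close>

definition cayley :: "nat list \<Rightarrow> bool" where
  "cayley w \<longleftrightarrow> set w = {1..max_value w}"

definition first_occ :: "nat list \<Rightarrow> nat \<Rightarrow> nat" where
  "first_occ w v = (LEAST i. i < length w \<and> w ! i = v)"

definition rgf :: "nat list \<Rightarrow> bool" where
  "rgf w \<longleftrightarrow> cayley w \<and>
     (\<forall>v \<in> set w. \<forall>u. 1 \<le> u \<and> u < v \<longrightarrow> first_occ w u < first_occ w v)"

definition standardise :: "nat list \<Rightarrow> nat list" where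
  "standardise w = map (\<lambda>x. card {y \<in> set w. y \<le> x}) w"

definition contains :: "nat list \<Rightarrow> nat list \<Rightarrow> bool" where
  "contains w s \<longleftrightarrow> (\<exists>v. subseq v w \<and> standardise v = s)"

definition avoids :: "nat list \<Rightarrow> nat list \<Rightarrow> bool" where
  "avoids w s \<longleftrightarrow> \<not> contains w s"

definition rgf_avoiding :: "nat list set \<Rightarrow> nat list set" where
  "rgf_avoiding P = {w. rgf w \<and> (\<forall>s \<in> P. avoids w s)}"

definition rgf_class :: "nat list set \<Rightarrow> bool" where
  "rgf_class R \<longleftrightarrow> (\<exists>P. (\<forall>s \<in> P. cayley s) \<and> R = rgf_avoiding P)"


section \<open>Vertical evolution\<close>

datatype letter = Slot | Entry nat

text \<open>Positions of \<open>w\<close> (counted from 0) in order of insertion. Since \<^const>\<open>sort_key\<close> is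
  stable, equal values are inserted from left to right.\<close>

definition insertion_order :: "nat list \<Rightarrow> nat list" where
  "insertion_order w = sort_key (\<lambda>i. w ! i) [0..<length w]"

fun merge_slots :: "letter list \<Rightarrow> letter list" where
  "merge_slots [] = []"
| "merge_slots (Slot # Slot # xs) = merge_slots (Slot # xs)"
| "merge_slots (x # xs) = x # merge_slots xs"

definition configuration :: "nat list \<Rightarrow> nat \<Rightarrow> letter list" where
  "configuration w t = merge_slots
     (map (\<lambda>i. if i \<in> set (take t (insertion_order w)) then Entry (w ! i) else Slot)
       [0..<length w])"

definition vertical_evolution :: "nat list \<Rightarrow> letter list list" where
  "vertical_evolution w = map (configuration w) [0..<length w + 1]"

definition SB_V :: "nat \<Rightarrow> nat list set" where
  "SB_V k = {w. rgf w \<and> (\<forall>x \<in> set (vertical_evolution w). count_list x Slot \<le> k)}"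


section \<open>Grid classes\<close>

datatype cell = Increasing | Decreasing | Constant | Zero

fun fits_cell :: "cell \<Rightarrow> nat list \<Rightarrow> bool" where
  "fits_cell Increasing w \<longleftrightarrow> sorted_wrt (<) w"
| "fits_cell Decreasing w \<longleftrightarrow> sorted_wrt (>) w"
| "fits_cell Constant w \<longleftrightarrow> (\<forall>x \<in> set w. \<forall>y \<in> set w. x = y)"
| "fits_cell Zero w \<longleftrightarrow> w = []"

text \<open>A matrix is the nonempty list of its rows, from top to bottom as displayed, each row being
  read from left to right; all rows have the same length.  Columns are indexed from the left and
  rows from the bottom, both starting from 1.\<close>

type_synonym cell_matrix = "cell list list"

definition n_cols :: "cell_matrix \<Rightarrow> nat" where
  "n_cols M = length (hd M)"

definition n_rows :: "cell_matrix \<Rightarrow> nat" where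
  "n_rows M = length M"

definition matrix_entry :: "cell_matrix \<Rightarrow> nat \<Rightarrow> nat \<Rightarrow> cell" where
  "matrix_entry M k l = M ! (n_rows M - l) ! (k - 1)"

text \<open>Indices of entries are counted from 1 in \<open>A\<close>, whereas \<^const>\<open>nths\<close> counts from 0.\<close>

definition window :: "nat list \<Rightarrow> nat set \<Rightarrow> nat set \<Rightarrow> nat list" where
  "window w A B = filter (\<lambda>x. x \<in> B) (nths w {i. i + 1 \<in> A})"

text \<open>Only the values \<open>c 1, \<dots>, c (n_cols M + 1)\<close> and \<open>r 1, \<dots>, r (n_rows M + 1)\<close> matter.\<close>

definition is_gridding ::
    "cell_matrix \<Rightarrow> nat list \<Rightarrow> (nat \<Rightarrow> nat) \<Rightarrow> (nat \<Rightarrow> nat) \<Rightarrow> bool" where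
  "is_gridding M w c r \<longleftrightarrow>
     c 1 = 1 \<and> (\<forall>k \<in> {1..n_cols M}. c k \<le> c (k + 1)) \<and> c (n_cols M + 1) = length w + 1 \<and>
     r 1 = 1 \<and> (\<forall>l \<in> {1..n_rows M}. r l \<le> r (l + 1)) \<and> r (n_rows M + 1) = max_value w + 1 \<and>
     (\<forall>k \<in> {1..n_cols M}. \<forall>l \<in> {1..n_rows M}.
        fits_cell (matrix_entry M k l) (window w {c k..<c (k + 1)} {r l..<r (l + 1)}))"

definition grid_class :: "cell_matrix \<Rightarrow> nat list set" where
  "grid_class M = {w. cayley w \<and> (\<exists>c r. is_gridding M w c r)}"

definition G_class :: "cell \<Rightarrow> cell \<Rightarrow> nat list set" where
  "G_class A B = grid_class [[Zero, B],
                             [Increasing, A]]"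

definition V_class :: "cell \<Rightarrow> cell \<Rightarrow> nat list set" where
  "V_class A B = grid_class [[B],
                             [A]]"

end

theory Submission
  imports Defs "HOL-Library.Ramsey"
begin

text \<open>
  Call an \<^emph>\<open>alternation\<close> of length \<open>n\<close> in a word a choice of \<open>n\<close> lower and \<open>n\<close> upper entries,
  every lower value below every upper value, that occur in the order lower, upper, lower, upper,
  and so on.  The theorem holds because the number of slots, the length of alternations and the nine
  grid classes all measure the same thing.

  \<^item> \<^emph>\<open>Slots and alternations.\<close> At the moment when exactly the values up to the largest lower value
    have been inserted, the upper entries of an alternation lie in different slots
    (\<open>slots_of_alternation\<close>).  Conversely, a configuration with many slots gives many inserted
    entries separated by missing ones.  Both kinds may contain the value \<open>v\<close> that is being inserted,
    but since equal values are inserted from left to right, the last inserted \<open>v\<close> cuts the word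
    into a left part, whose missing values exceed \<open>v\<close>, and a right part, whose inserted values are
    below \<open>v\<close>; the longer part is an alternation (\<open>alternation_of_slots\<close>).

  \<^item> \<^emph>\<open>Classes have long alternations.\<close> Each of the nine classes contains, for every \<open>n\<close>, a Cayley
    permutation with an alternation of length \<open>n\<close> (\<open>ex_alternation_in_class\<close>).  Containment preserves
    alternations, so a class of words with boundedly many slots avoids one of them.

  \<^item> \<^emph>\<open>Long alternations contain everything in some class.\<close> By Ramsey's theorem a long alternation
    can be thinned out so that its lower entries are strictly increasing, strictly decreasing or
    constant, and so are its upper entries (\<open>ex_uniform_alternation\<close>).  If the lower entries are
    constant, any element of the corresponding class \<open>V\<close> can be read off: take from each pair the
    lower or the upper entry (\<open>contains_V_pattern\<close>).  If they are strictly monotone, the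
    word being a restricted growth function supplies, before the first upper entry, an increasing
    sequence of first occurrences of all smaller values.  This is the bottom left cell of the
    class \<open>G\<close>, and the alternation provides the two cells on the right, with enough room to realise any
    interleaving of them (\<open>contains_G_pattern\<close>).  So avoiding one element of each class bounds the
    length of alternations, and with it the number of slots.
\<close>

section \<open>Containment as an embedding of positions\<close>

lemma subseq_iff_nth:
  "subseq v w \<longleftrightarrow> (\<exists>f. strict_mono_on {..<length v} f \<and>
     (\<forall>i<length v. f i < length w \<and> w ! f i = v ! i))"
proof
  assume "subseq v w"
  then show "\<exists>f. strict_mono_on {..<length v} f \<and> (\<forall>i<length v. f i < length w \<and> w ! f i = v ! i)"
  proof (induction v w rule: list_emb.induct)
    case (list_emb_Nil ys)
    then show ?case by (auto simp: strict_mono_on_def)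
  next
    case (list_emb_Cons xs ys y)
    then obtain f where f: "strict_mono_on {..<length xs} f"
      "\<forall>i<length xs. f i < length ys \<and> ys ! f i = xs ! i" by blast
    then show ?case
      by (intro exI[of _ "\<lambda>i. Suc (f i)"]) (auto simp: strict_mono_on_def)
  next
    case (list_emb_Cons2 x y xs ys)
    then obtain f where f: "strict_mono_on {..<length xs} f"
      "\<forall>i<length xs. f i < length ys \<and> ys ! f i = xs ! i" by blast
    define g where "g i = (case i of 0 \<Rightarrow> 0 | Suc j \<Rightarrow> Suc (f j))" for i
    have "strict_mono_on {..<length (x#xs)} g"
      using f(1) by (auto simp: strict_mono_on_def g_def split: nat.split)
    moreover have "\<forall>i<length (x#xs). g i < length (y#ys) \<and> (y#ys) ! g i = (x#xs) ! i"
      using f(2) list_emb_Cons2(1) by (auto simp: g_def split: nat.split)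
    ultimately show ?case by blast
  qed
next
  assume "\<exists>f. strict_mono_on {..<length v} f \<and> (\<forall>i<length v. f i < length w \<and> w ! f i = v ! i)"
  then obtain f where f: "strict_mono_on {..<length v} f"
    "\<forall>i<length v. f i < length w \<and> w ! f i = v ! i" by blast
  have "subseq (map f [0..<length v]) [0..<length w]"
  proof (rule sorted_subset_imp_subseq)
    show "set (map f [0..<length v]) \<subseteq> set [0..<length w]" using f(2) by auto
    show "sorted_wrt (<) (map f [0..<length v])"
      using f(1) by (auto simp: sorted_wrt_iff_nth_less strict_mono_on_def)
    show "sorted [0..<length w]" by simp
  qed
  then have "subseq (map ((!) w) (map f [0..<length v])) (map ((!) w) [0..<length w])"
    by (rule subseq_map)
  moreover have "map ((!) w) (map f [0..<length v]) = v"
    using f(2) by (intro nth_equalityI) auto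
  ultimately show "subseq v w" by (simp add: map_nth)
qed

text \<open>
  The standardisation of a word is the only Cayley permutation that is order isomorphic to it: in a
  Cayley permutation the number of distinct values below or equal to a value is that value itself.
\<close>
lemma standardise_eq_iff:
  assumes "cayley s"
  shows "standardise v = s \<longleftrightarrow> length v = length s \<and>
    (\<forall>i<length s. \<forall>j<length s. v ! i < v ! j \<longleftrightarrow> s ! i < s ! j)"
proof
  assume s: "standardise v = s"
  let ?r = "\<lambda>x. card {y \<in> set v. y \<le> x}"
  have mono: "?r x < ?r y" if "x < y" "y \<in> set v" for x y
  proof (rule psubset_card_mono)
    have "y \<in> {z \<in> set v. z \<le> y}" "y \<notin> {z \<in> set v. z \<le> x}" using that by auto
    moreover have "{z \<in> set v. z \<le> x} \<subseteq> {z \<in> set v. z \<le> y}" using that by auto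
    ultimately show "{z \<in> set v. z \<le> x} \<subset> {z \<in> set v. z \<le> y}" by blast
  qed simp
  have "?r x < ?r y \<longleftrightarrow> x < y" if "x \<in> set v" "y \<in> set v" for x y
    using mono[of x y] mono[of y x] that by (cases x y rule: linorder_cases) auto
  then show "length v = length s \<and> (\<forall>i<length s. \<forall>j<length s. v ! i < v ! j \<longleftrightarrow> s ! i < s ! j)"
    using s by (auto simp: standardise_def)
next
  assume a: "length v = length s \<and> (\<forall>i<length s. \<forall>j<length s. v ! i < v ! j \<longleftrightarrow> s ! i < s ! j)"
  show "standardise v = s"
  proof (rule nth_equalityI)
    fix i assume "i < length (standardise v)"
    then have i: "i < length s" using a by (simp add: standardise_def)
    let ?J = "{j. j < length s \<and> s ! j \<le> s ! i}"
    have le: "v ! j \<le> v ! k \<longleftrightarrow> s ! j \<le> s ! k" if "j < length s" "k < length s" for j k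
      using a that by (simp flip: not_less)
    have eq: "v ! j = v ! k \<longleftrightarrow> s ! j = s ! k" if "j < length s" "k < length s" for j k
      using le[OF that] le[OF that(2,1)] by (simp add: order_eq_iff)
    have V: "{y \<in> set v. y \<le> v ! i} = (!) v ` ?J"
      using a i le by (auto simp: in_set_conv_nth image_iff)
    have S: "{y \<in> set s. y \<le> s ! i} = (!) s ` ?J"
      by (auto simp: in_set_conv_nth)
    have "card ((!) v ` ?J) = card ((\<lambda>y. v ! (SOME j. j < length s \<and> s ! j = y)) ` ((!) s ` ?J))"
    proof -
      have "v ! (SOME k. k < length s \<and> s ! k = s ! j) = v ! j" if "j \<in> ?J" for j
        using that someI[of "\<lambda>k. k < length s \<and> s ! k = s ! j" j] eq by auto
      then show ?thesis by (simp add: image_image)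
    qed
    also have "\<dots> = card ((!) s ` ?J)"
    proof (rule card_image, rule inj_onI)
      fix x y assume "x \<in> (!) s ` ?J" "y \<in> (!) s ` ?J"
        and e: "v ! (SOME j. j < length s \<and> s ! j = x) = v ! (SOME j. j < length s \<and> s ! j = y)"
      then have "\<exists>j. j < length s \<and> s ! j = x" "\<exists>j. j < length s \<and> s ! j = y" by auto
      from someI_ex[OF this(1)] someI_ex[OF this(2)] show "x = y"
        using e eq by metis
    qed
    also have "\<dots> = card {1..s ! i}"
    proof -
      have "s ! i \<in> {1..max_value s}" using assms i nth_mem by (force simp: cayley_def)
      then have "{y \<in> set s. y \<le> s ! i} = {1..s ! i}" using assms by (auto simp: cayley_def)
      then show ?thesis using S by simp
    qed
    finally show "standardise v ! i = s ! i" using V i a by (simp add: standardise_def)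
  qed (use a in \<open>simp add: standardise_def\<close>)
qed

text \<open>
  All constructions of patterns below go through this form, which mentions no subsequence.
\<close>
lemma contains_iff_embedding:
  assumes "cayley s"
  shows "contains w s \<longleftrightarrow> (\<exists>f. strict_mono_on {..<length s} f \<and>
    (\<forall>i<length s. f i < length w) \<and>
    (\<forall>i<length s. \<forall>j<length s. w ! f i < w ! f j \<longleftrightarrow> s ! i < s ! j))" (is "_ = (\<exists>f. ?E f)")
proof
  assume "contains w s"
  then obtain v f where "strict_mono_on {..<length v} f"
    "\<forall>i<length v. f i < length w \<and> w ! f i = v ! i" "standardise v = s"
    by (auto simp: contains_def subseq_iff_nth)
  then show "\<exists>f. ?E f" using assms by (auto simp: standardise_eq_iff intro!: exI[of _ f])
next
  assume "\<exists>f. ?E f"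
  then obtain f where f: "?E f" by blast
  then have "subseq (map (\<lambda>i. w ! f i) [0..<length s]) w"
    by (auto simp: subseq_iff_nth intro!: exI[of _ f])
  moreover have "standardise (map (\<lambda>i. w ! f i) [0..<length s]) = s"
    using f assms by (auto simp: standardise_eq_iff)
  ultimately show "contains w s" by (auto simp: contains_def)
qed

section \<open>The grid classes in terms of positions\<close>

text \<open>
  Every nonempty kind of cell is the requirement that the entries are pairwise related from left to
  right, so the three kinds can be treated alike.  For an empty cell this fails, because a one-letter
  sequence has no pairs; such cells are handled apart.
\<close>
definition cell_rel :: "cell \<Rightarrow> nat \<Rightarrow> nat \<Rightarrow> bool" where
  "cell_rel B x y \<longleftrightarrow> (case B of Increasing \<Rightarrow> x < y | Decreasing \<Rightarrow> x > y | Constant \<Rightarrow> x = y | Zero \<Rightarrow> False)"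

lemma fits_cell_iff_sorted_wrt:
  assumes "B \<noteq> Zero"
  shows "fits_cell B w \<longleftrightarrow> sorted_wrt (cell_rel B) w"
proof (cases B)
  case Constant
  have "sorted_wrt (=) w \<longleftrightarrow> (\<forall>x\<in>set w. \<forall>y\<in>set w. x = y)"
    by (induction w) auto
  then show ?thesis using Constant by (simp add: cell_rel_def[abs_def])
qed (use assms in \<open>simp_all add: cell_rel_def[abs_def]\<close>)

lemma window_eq_map:
  "window w A B = map ((!) w) (filter (\<lambda>i. i + 1 \<in> A \<and> w ! i \<in> B) [0..<length w])"
proof -
  have "zip w [0..<length w] = map (\<lambda>i. (w ! i, i)) [0..<length w]"
    by (intro nth_equalityI) auto
  then show ?thesis
    by (simp add: window_def nths_def filter_map o_def conj_commute)
qed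

lemma sorted_wrt_filter_upt:
  "sorted_wrt Q (filter P [0..<n]) \<longleftrightarrow> (\<forall>j<n. \<forall>i<j. P i \<and> P j \<longrightarrow> Q i j)"
  by (induction n) (auto simp: sorted_wrt_append less_Suc_eq)

lemma fits_cell_window:
  assumes "B \<noteq> Zero"
  shows "fits_cell B (window w {a..<b} {c..<d}) \<longleftrightarrow>
    (\<forall>j<length w. \<forall>i<j. a \<le> i + 1 \<and> j + 1 < b \<and> w ! i \<in> {c..<d} \<and> w ! j \<in> {c..<d}
       \<longrightarrow> cell_rel B (w ! i) (w ! j))"
  unfolding fits_cell_iff_sorted_wrt[OF assms] window_eq_map sorted_wrt_map sorted_wrt_filter_upt
  by auto

lemma le_max_value: "x \<in> set w \<Longrightarrow> x \<le> max_value w"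
  by (simp add: max_value_def)

lemma cayley_pos: "cayley w \<Longrightarrow> x \<in> set w \<Longrightarrow> 0 < x"
  by (auto simp: cayley_def)

lemma cayleyI: "set w = {1..m} \<Longrightarrow> cayley w"
proof -
  assume a: "set w = {1..m}"
  have "Max (insert 0 {1..m}) = m" by (rule Max_eqI) (auto simp: Suc_le_eq)
  then show ?thesis using a by (simp add: cayley_def max_value_def)
qed

lemma is_gridding_column:
  "is_gridding [[B], [A]] w c r \<longleftrightarrow>
     c 1 = 1 \<and> c 2 = length w + 1 \<and> r 1 = 1 \<and> 1 \<le> r 2 \<and> r 2 \<le> r 3 \<and> r 3 = max_value w + 1 \<and>
     fits_cell A (window w {c 1..<c 2} {r 1..<r 2}) \<and> fits_cell B (window w {c 1..<c 2} {r 2..<r 3})"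
proof -
  have "{1..n_cols [[B], [A]]} = {1}" "n_cols [[B], [A]] + 1 = 2" by (auto simp: n_cols_def)
  moreover have "{1..n_rows [[B], [A]]} = {1, 2}" "n_rows [[B], [A]] + 1 = 3" by (auto simp: n_rows_def)
  moreover have "matrix_entry [[B], [A]] 1 1 = A" "matrix_entry [[B], [A]] 1 2 = B"
    by (auto simp: matrix_entry_def n_rows_def)
  moreover have "(1::nat) + 1 = 2" "(2::nat) + 1 = 3" by auto
  ultimately show ?thesis unfolding is_gridding_def by (simp only: ball_simps) auto
qed

lemma is_gridding_square:
  "is_gridding [[B', B], [A', A]] w c r \<longleftrightarrow>
     c 1 = 1 \<and> 1 \<le> c 2 \<and> c 2 \<le> c 3 \<and> c 3 = length w + 1 \<and>
     r 1 = 1 \<and> 1 \<le> r 2 \<and> r 2 \<le> r 3 \<and> r 3 = max_value w + 1 \<and>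
     fits_cell A' (window w {c 1..<c 2} {r 1..<r 2}) \<and> fits_cell B' (window w {c 1..<c 2} {r 2..<r 3}) \<and>
     fits_cell A (window w {c 2..<c 3} {r 1..<r 2}) \<and> fits_cell B (window w {c 2..<c 3} {r 2..<r 3})"
proof -
  let ?M = "[[B', B], [A', A]]"
  have "{1..n_cols ?M} = {1, 2}" "n_cols ?M + 1 = 3" by (auto simp: n_cols_def)
  moreover have "{1..n_rows ?M} = {1, 2}" "n_rows ?M + 1 = 3" by (auto simp: n_rows_def)
  moreover have "matrix_entry ?M 1 1 = A'" "matrix_entry ?M 1 2 = B'" "matrix_entry ?M 2 1 = A" "matrix_entry ?M 2 2 = B"
    by (auto simp: matrix_entry_def n_rows_def)
  moreover have "(1::nat) + 1 = 2" "(2::nat) + 1 = 3" by auto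
  ultimately show ?thesis unfolding is_gridding_def by (simp only: ball_simps) auto
qed

text \<open>
  The entries from position \<open>c\<close> (counted from 0) onwards fill the two cells of one column, with the
  values up to \<open>h\<close> in the lower cell of kind \<open>A\<close> and the others in the upper cell of kind \<open>B\<close>.
\<close>
definition two_layered :: "cell \<Rightarrow> cell \<Rightarrow> nat \<Rightarrow> nat \<Rightarrow> nat list \<Rightarrow> bool" where
  "two_layered A B h c w \<longleftrightarrow> (\<forall>j<length w. \<forall>i<j. c \<le> i \<longrightarrow>
     (w ! i \<le> h \<and> w ! j \<le> h \<longrightarrow> cell_rel A (w ! i) (w ! j)) \<and>
     (h < w ! i \<and> h < w ! j \<longrightarrow> cell_rel B (w ! i) (w ! j)))"

lemma two_layered_iff_windows:
  assumes "cayley w" "A \<noteq> Zero" "B \<noteq> Zero"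
  shows "two_layered A B h c w \<longleftrightarrow>
    fits_cell A (window w {c + 1..<length w + 1} {1..<h + 1}) \<and>
    fits_cell B (window w {c + 1..<length w + 1} {h + 1..<max_value w + 1})"
proof -
  have le: "w ! i \<le> max_value w" "0 < w ! i" if "i < length w" for i
    using that le_max_value cayley_pos[OF assms(1)] by auto
  have A: "(c + 1 \<le> i + 1 \<and> j + 1 < length w + 1 \<and> w ! i \<in> {1..<h + 1} \<and> w ! j \<in> {1..<h + 1}) \<longleftrightarrow>
      c \<le> i \<and> w ! i \<le> h \<and> w ! j \<le> h"
    and B: "(c + 1 \<le> i + 1 \<and> j + 1 < length w + 1 \<and> w ! i \<in> {h + 1..<max_value w + 1} \<and>
      w ! j \<in> {h + 1..<max_value w + 1}) \<longleftrightarrow> c \<le> i \<and> h < w ! i \<and> h < w ! j"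
    if "i < j" "j < length w" for i j
    using le[of i] le[of j] that by auto
  show ?thesis
    unfolding two_layered_def fits_cell_window[OF assms(2)] fits_cell_window[OF assms(3)]
    using A B by blast
qed

lemma V_class_iff:
  assumes "A \<noteq> Zero" "B \<noteq> Zero"
  shows "s \<in> V_class A B \<longleftrightarrow> cayley s \<and> (\<exists>h \<le> max_value s. two_layered A B h 0 s)"
proof -
  have "(\<exists>c r. is_gridding [[B],[A]] s c r) \<longleftrightarrow> (\<exists>h \<le> max_value s. two_layered A B h 0 s)"
    if s: "cayley s"
  proof
    assume "\<exists>c r. is_gridding [[B],[A]] s c r"
    then obtain c r where g: "is_gridding [[B],[A]] s c r" by (elim exE)
    define h where "h = r 2 - 1"
    have h: "r 2 = h + 1" "h \<le> max_value s" using g unfolding h_def is_gridding_column by linarith+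
    have "two_layered A B h 0 s"
      using g unfolding two_layered_iff_windows[OF s assms] is_gridding_column h by (elim conjE) simp
    then show "\<exists>h \<le> max_value s. two_layered A B h 0 s" using h by blast
  next
    assume "\<exists>h \<le> max_value s. two_layered A B h 0 s"
    then obtain h where h: "h \<le> max_value s" "two_layered A B h 0 s" by blast
    then have "is_gridding [[B],[A]] s (\<lambda>k. if k = 1 then 1 else length s + 1)
        (\<lambda>k. if k = 1 then 1 else if k = 2 then h + 1 else max_value s + 1)"
      unfolding two_layered_iff_windows[OF s assms] is_gridding_column by simp
    then show "\<exists>c r. is_gridding [[B],[A]] s c r" by (intro exI)
  qed
  then show ?thesis unfolding V_class_def grid_class_def mem_Collect_eq by (rule conj_cong[OF refl])
qed

text \<open>
  The first column of a class \<open>G\<close>: increasing at the bottom, empty at the top.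
\<close>
definition increasing_prefix :: "nat \<Rightarrow> nat \<Rightarrow> nat list \<Rightarrow> bool" where
  "increasing_prefix h c w \<longleftrightarrow> c \<le> length w \<and> (\<forall>i<c. w ! i \<le> h) \<and> (\<forall>j<c. \<forall>i<j. w ! i < w ! j)"

lemma increasing_prefix_iff_windows:
  assumes "cayley w" "c \<le> length w"
  shows "increasing_prefix h c w \<longleftrightarrow>
    fits_cell Increasing (window w {1..<c + 1} {1..<h + 1}) \<and>
    fits_cell Zero (window w {1..<c + 1} {h + 1..<max_value w + 1})"
proof -
  have le: "w ! i \<le> max_value w" "0 < w ! i" if "i < length w" for i
    using that le_max_value cayley_pos[OF assms(1)] by auto
  have I: "Increasing \<noteq> Zero" by simp
  have Z: "fits_cell Zero (window w {1..<c + 1} {h + 1..<max_value w + 1}) \<longleftrightarrow> (\<forall>i<c. w ! i \<le> h)"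
  proof -
    have "\<not> (i + 1 \<in> {1..<c + 1} \<and> w ! i \<in> {h + 1..<max_value w + 1}) \<longleftrightarrow> (i < c \<longrightarrow> w ! i \<le> h)"
      if "i < length w" for i
      using le(1)[OF that] by auto
    then have "fits_cell Zero (window w {1..<c + 1} {h + 1..<max_value w + 1}) \<longleftrightarrow>
      (\<forall>i<length w. i < c \<longrightarrow> w ! i \<le> h)"
      unfolding window_eq_map fits_cell.simps map_is_Nil_conv filter_empty_conv by auto
    then show ?thesis using assms(2) by (meson less_le_trans)
  qed
  have "(1 \<le> i + 1 \<and> j + 1 < c + 1 \<and> w ! i \<in> {1..<h + 1} \<and> w ! j \<in> {1..<h + 1}) \<longleftrightarrow>
      j < c \<and> w ! i \<le> h \<and> w ! j \<le> h"
    if "i < j" "j < length w" for i j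
    using le[of i] le[of j] that by auto
  then have "fits_cell Increasing (window w {1..<c + 1} {1..<h + 1}) \<longleftrightarrow>
    (\<forall>j<length w. \<forall>i<j. j < c \<and> w ! i \<le> h \<and> w ! j \<le> h \<longrightarrow> w ! i < w ! j)"
    unfolding fits_cell_window[OF I] by (simp add: cell_rel_def)
  then show ?thesis
    using assms(2) unfolding Z increasing_prefix_def by (meson less_le_trans less_trans)
qed

lemma G_class_iff:
  assumes "A \<noteq> Zero" "B \<noteq> Zero"
  shows "s \<in> G_class A B \<longleftrightarrow> cayley s \<and> (\<exists>c h. h \<le> max_value s \<and>
     increasing_prefix h c s \<and> two_layered A B h c s)" (is "_ \<longleftrightarrow> cayley s \<and> ?R")
proof -
  have "(\<exists>c r. is_gridding [[Zero,B],[Increasing,A]] s c r) \<longleftrightarrow> ?R" if s: "cayley s"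
  proof
    assume "\<exists>c r. is_gridding [[Zero,B],[Increasing,A]] s c r"
    then obtain c r where g: "is_gridding [[Zero,B],[Increasing,A]] s c r" by (elim exE)
    define k h where "k = c 2 - 1" and "h = r 2 - 1"
    have h: "c 2 = k + 1" "r 2 = h + 1" "k \<le> length s" "h \<le> max_value s"
      using g unfolding k_def h_def is_gridding_square by linarith+
    have "increasing_prefix h k s \<and> two_layered A B h k s"
      using g unfolding two_layered_iff_windows[OF s assms] increasing_prefix_iff_windows[OF s h(3)]
        is_gridding_square h(1,2) by (elim conjE) simp
    then show ?R using h(4) by blast
  next
    assume ?R
    then obtain k h where h: "h \<le> max_value s" "increasing_prefix h k s" "two_layered A B h k s"
      by blast
    then have k: "k \<le> length s" by (simp add: increasing_prefix_def)
    have "is_gridding [[Zero,B],[Increasing,A]] s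
      (\<lambda>j. if j = 1 then 1 else if j = 2 then k + 1 else length s + 1)
      (\<lambda>j. if j = 1 then 1 else if j = 2 then h + 1 else max_value s + 1)"
      using h k unfolding two_layered_iff_windows[OF s assms] increasing_prefix_iff_windows[OF s k]
        is_gridding_square by simp
    then show "\<exists>c r. is_gridding [[Zero,B],[Increasing,A]] s c r" by (intro exI)
  qed
  then show ?thesis unfolding G_class_def grid_class_def mem_Collect_eq by (rule conj_cong[OF refl])
qed

definition monotone_cells :: "cell set" where
  "monotone_cells = {Increasing, Decreasing, Constant}"

text \<open>
  The nine classes of the theorem, indexed by the cells that are to hold the lower and the upper
  entries of an alternation.
\<close>
definition alternating_class :: "cell \<Rightarrow> cell \<Rightarrow> nat list set" where
  "alternating_class A B = (if A = Constant then V_class Constant B else G_class A B)"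

lemma alternating_class_cayley: "s \<in> alternating_class A B \<Longrightarrow> cayley s"
  by (simp add: alternating_class_def V_class_def G_class_def grid_class_def split: if_splits)

section \<open>Alternations\<close>

text \<open>
  Stating that all lower values are below all upper ones, without a separating threshold, makes the
  notion invariant under order isomorphism.
\<close>
definition alternation :: "nat list \<Rightarrow> nat \<Rightarrow> (nat \<Rightarrow> nat) \<Rightarrow> (nat \<Rightarrow> nat) \<Rightarrow> bool" where
  "alternation w n p q \<longleftrightarrow> (\<forall>i<n. p i < q i \<and> q i < length w) \<and>
     (\<forall>j<n. \<forall>i<j. q i < p j) \<and> (\<forall>i<n. \<forall>j<n. w ! p i < w ! q j)"

lemma alternation_mono:
  assumes "alternation w n p q" "m \<le> n"
  shows "alternation w m p q"
  using assms unfolding alternation_def by (meson order_less_le_trans)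

lemma alternation_subsequence:
  assumes "alternation w N p q" "\<And>i. i < n \<Longrightarrow> e i < N" "\<And>i j. i < j \<Longrightarrow> j < n \<Longrightarrow> e i < e j"
  shows "alternation w n (p \<circ> e) (q \<circ> e)"
  using assms unfolding alternation_def by auto

lemma alternation_order:
  assumes "alternation w n p q" "j < n" "i \<le> j"
  shows "p i \<le> p j" "q i \<le> q j" "p i < q j" "i < j \<Longrightarrow> p i < p j" "i < j \<Longrightarrow> q i < q j" "i < j \<Longrightarrow> q i < p j"
proof -
  have 1: "p i < q i" "p j < q j" using assms unfolding alternation_def by auto
  have 2: "q i < p j" if "i < j" using assms that unfolding alternation_def by auto
  show "i < j \<Longrightarrow> p i < p j" "i < j \<Longrightarrow> q i < q j" "i < j \<Longrightarrow> q i < p j"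
    using 1 2 by auto
  show "p i \<le> p j" "q i \<le> q j" "p i < q j"
    using 1 2 assms(3) by (cases "i = j"; simp)+
qed

lemma alternation_of_contained:
  assumes "alternation s n p q" "contains w s" "cayley s"
  shows "\<exists>p q. alternation w n p q"
proof -
  obtain f where f: "strict_mono_on {..<length s} f" "\<forall>i<length s. f i < length w"
    "\<forall>i<length s. \<forall>j<length s. w ! f i < w ! f j \<longleftrightarrow> s ! i < s ! j"
    using assms(2,3) contains_iff_embedding by blast
  have lt: "p i < length s" "q i < length s" if "i < n" for i
    using assms(1) that unfolding alternation_def by (auto intro: less_trans)
  have "alternation w n (f \<circ> p) (f \<circ> q)"
    using assms(1) f lt unfolding alternation_def strict_mono_on_def by simp
  then show ?thesis by (intro exI)
qed

section \<open>Slots and alternations\<close>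

fun is_slot :: "letter \<Rightarrow> bool" where
  "is_slot Slot = True"
| "is_slot (Entry _) = False"

text \<open>
  The recursion of \<^const>\<open>merge_slots\<close> matches its second and later equations in sequence, which
  splits them into overlapping cases; this rule distinguishes lists by their leading letters only.
\<close>
lemma slot_runs_induct [case_names Nil Entry single_Slot Slot_Slot Slot_Entry]:
  assumes "P []" "\<And>v xs. P xs \<Longrightarrow> P (Entry v # xs)" "P [Slot]"
    "\<And>xs. P (Slot # xs) \<Longrightarrow> P (Slot # Slot # xs)"
    "\<And>v xs. P (Entry v # xs) \<Longrightarrow> P (Slot # Entry v # xs)"
  shows "P xs"
proof (induction xs rule: merge_slots.induct)
  case ("3_2" x)
  then show ?case using assms by (cases x) auto
next
  case ("3_3" x v xs)
  then show ?case using assms by (cases x) auto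
qed (use assms in auto)

text \<open>
  The word \<open>entry, slot, entry, slot, \<dots>\<close>; slots are represented by \<^const>\<open>True\<close>.
\<close>
definition alternating :: "nat \<Rightarrow> bool list" where
  "alternating n = concat (replicate n [False, True])"

lemma alternating_simps [simp]:
  "alternating 0 = []" "alternating (Suc n) = False # True # alternating n"
  by (simp_all add: alternating_def)

lemma alternating_nth:
  "length (alternating n) = 2 * n"
  "i < 2 * n \<Longrightarrow> alternating n ! i = odd i"
proof -
  show "length (alternating n) = 2 * n" by (induction n) auto
  show "i < 2 * n \<Longrightarrow> alternating n ! i = odd i"
  proof (induction n arbitrary: i)
    case (Suc n)
    then show ?case by (cases i; cases "i - 1") auto
  qed simp
qed

text \<open>
  An alternating word takes at most one letter from each run of slots, so merging the runs does not
  destroy it.  The second statement is needed for the induction, to describe the situation after an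
  entry has been matched.
\<close>
lemma subseq_alternating_merge_slots:
  "subseq (alternating n) (map is_slot xs) \<Longrightarrow> subseq (alternating n) (map is_slot (merge_slots xs))"
  "subseq (True # alternating n) (map is_slot xs) \<Longrightarrow> subseq (True # alternating n) (map is_slot (merge_slots xs))"
proof (induction xs arbitrary: n rule: slot_runs_induct)
  case (Entry v xs)
  {
    case 1
    show ?case
    proof (cases n)
      case (Suc m)
      then show ?thesis using 1 Entry(2)[of m] by simp
    qed simp
  next
    case 2
    then have "subseq (True # alternating n) (map is_slot xs)" by (simp add: list_emb_Cons_iff2)
    then show ?case using Entry(2)[of n] by (simp add: list_emb_Cons_iff2)
  }
next
  case (Slot_Slot xs)
  {
    case 1
    have "subseq (alternating n) (True # map is_slot xs)"
      using 1 by (cases n) (simp_all add: list_emb_Cons_iff2)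
    then show ?case using Slot_Slot(1)[of n] by simp
  next
    case 2
    have "subseq (alternating n) (map is_slot xs)"
      using 2 by (cases n) (simp_all add: list_emb_Cons_iff2)
    then show ?case using Slot_Slot(2)[of n] by simp
  }
next
  case (Slot_Entry v xs)
  {
    case 1
    show ?case
    proof (cases n)
      case (Suc m)
      then show ?thesis using 1 Slot_Entry(1)[of n] by (simp add: list_emb_Cons_iff2)
    qed simp
  next
    case 2
    then show ?case using Slot_Entry(1)[of n] by simp
  }
qed auto

lemma subseq_alternating_iff:
  "subseq (alternating n) bs \<longleftrightarrow> (\<exists>p q. (\<forall>i<n. p i < q i \<and> q i < length bs) \<and>
     (\<forall>j<n. \<forall>i<j. q i < p j) \<and> (\<forall>i<n. \<not> bs ! p i \<and> bs ! q i))" (is "_ \<longleftrightarrow> (\<exists>p q. ?R p q)")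
proof
  assume "subseq (alternating n) bs"
  then obtain f where f: "strict_mono_on {..<2 * n} f"
    "\<forall>i<2 * n. f i < length bs \<and> bs ! f i = odd i"
    unfolding subseq_iff_nth by (auto simp: alternating_nth)
  have "?R (\<lambda>i. f (2 * i)) (\<lambda>i. f (2 * i + 1))"
    using f by (auto simp: strict_mono_on_def)
  then show "\<exists>p q. ?R p q" by (intro exI)
next
  assume "\<exists>p q. ?R p q"
  then obtain p q where pq: "?R p q" by (elim exE)
  define f where "f i = (if even i then p (i div 2) else q (i div 2))" for i
  have pqi: "p i < q i" "q i < length bs" "\<not> bs ! p i" "bs ! q i" if "i < n" for i
    using pq that by auto
  have qp: "q i < p j" if "i < j" "j < n" for i j
    using pq that by auto
  have "f i < f j" if ij: "i < j" "j < 2 * n" for i j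
  proof (cases "i div 2 = j div 2")
    case True
    then have "even i" "odd j" using ij by presburger+
    then show ?thesis using True ij pqi[of "j div 2"] by (simp add: f_def)
  next
    case False
    then have "i div 2 < j div 2" using ij by linarith
    moreover have "i div 2 < n" "j div 2 < n" using ij by auto
    ultimately show ?thesis
      using qp[of "i div 2" "j div 2"] pqi[of "i div 2"] pqi[of "j div 2"] by (auto simp: f_def)
  qed
  moreover have "f i < length bs \<and> bs ! f i = odd i" if "i < 2 * n" for i
    using that pqi[of "i div 2"] by (auto simp: f_def)
  ultimately show "subseq (alternating n) bs"
    unfolding subseq_iff_nth by (intro exI[of _ f]) (auto simp: alternating_nth strict_mono_on_def)
qed

lemma count_slots_ge:
  assumes "subseq (alternating n) (map is_slot xs)"
  shows "n \<le> count_list xs Slot"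
proof -
  have 1: "length (filter id (alternating n)) = n" by (induction n) auto
  have 2: "length (filter id (map is_slot xs)) = count_list xs Slot"
  proof (induction xs)
    case (Cons x xs)
    then show ?case by (cases x) auto
  qed simp
  have "subseq (filter id (alternating n)) (filter id (map is_slot xs))"
    using assms by (rule subseq_filter)
  then show ?thesis using 1 2 list_emb_length by fastforce
qed

lemma count_merge_slots_Slot: "0 < count_list (merge_slots (Slot # xs)) Slot"
proof (induction xs)
  case (Cons x xs)
  then show ?case by (cases x) auto
qed simp

text \<open>
  Consecutive slots of a merged list are separated by entries; a slot at the very beginning is lost,
  as no entry precedes it.
\<close>
lemma subseq_alternating_of_slots:
  "subseq (alternating (count_list (merge_slots xs) Slot - (if xs \<noteq> [] \<and> hd xs = Slot then 1 else 0)))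
     (map is_slot xs)"
proof (induction xs rule: slot_runs_induct)
  case (Entry v xs)
  show ?case
  proof (cases "xs \<noteq> [] \<and> hd xs = Slot")
    case True
    then obtain ys where ys: "xs = Slot # ys" by (cases xs) auto
    obtain c where c: "count_list (merge_slots xs) Slot = Suc c"
      using count_merge_slots_Slot[of ys] ys gr0_implies_Suc by blast
    then have "subseq (alternating c) (True # map is_slot ys)" using Entry True ys by simp
    then have "subseq (alternating c) (map is_slot ys)" by (cases c) (simp_all add: list_emb_Cons_iff2)
    then show ?thesis using c ys by simp
  next
    case False
    then have "subseq (alternating (count_list (merge_slots xs) Slot)) (map is_slot xs)"
      using Entry by auto
    then show ?thesis by auto
  qed
qed auto

text \<open>
  Insertion sorts the positions by value and, by stability of the sorting, equal values by position.
\<close>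
lemma insertion_order_lex:
  "sorted_wrt (\<lambda>i j. w ! i < w ! j \<or> w ! i = w ! j \<and> i < j) (insertion_order w)"
proof -
  have ins: "sorted_wrt (\<lambda>i j. f i < f j \<or> f i = f j \<and> i < j) (insort_key f x ys)"
    if "sorted_wrt (\<lambda>i j. f i < f j \<or> f i = f j \<and> i < j) ys" "\<forall>y\<in>set ys. x < y"
    for f :: "nat \<Rightarrow> nat" and x ys
    using that by (induction ys) (auto simp: set_insort_key)
  have "sorted_wrt (\<lambda>i j. f i < f j \<or> f i = f j \<and> i < j) (sort_key f xs)" if "sorted_wrt (<) xs"
    for f :: "nat \<Rightarrow> nat" and xs
    using that by (induction xs) (auto intro!: ins)
  then show ?thesis by (simp add: insertion_order_def)
qed

lemma set_insertion_order: "set (insertion_order w) = {..<length w}"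
  by (auto simp: insertion_order_def)

lemma inserted_before:
  assumes "i \<in> set (take t (insertion_order w))" "j \<notin> set (take t (insertion_order w))" "j < length w"
  shows "w ! i < w ! j \<or> w ! i = w ! j \<and> i < j"
proof -
  have "j \<in> set (take t (insertion_order w) @ drop t (insertion_order w))"
    unfolding append_take_drop_id using assms(3) set_insertion_order by auto
  then have "j \<in> set (drop t (insertion_order w))" using assms(2) unfolding set_append by blast
  moreover have "sorted_wrt (\<lambda>i j. w ! i < w ! j \<or> w ! i = w ! j \<and> i < j)
      (take t (insertion_order w) @ drop t (insertion_order w))"
    unfolding append_take_drop_id by (rule insertion_order_lex)
  ultimately show ?thesis using assms(1) unfolding sorted_wrt_append by blast
qed

text \<open>
  Insertion goes by increasing value, so at some time exactly the entries up to \<open>h\<close> are present.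
\<close>
lemma ex_configuration_threshold:
  "\<exists>t \<le> length w. set (take t (insertion_order w)) = {i. i < length w \<and> w ! i \<le> h}"
proof -
  let ?o = "insertion_order w" and ?P = "\<lambda>i. w ! i \<le> h"
  let ?t = "length (takeWhile ?P ?o)"
  have "take ?t ?o = takeWhile ?P ?o" by (simp add: takeWhile_eq_take[symmetric])
  moreover have "takeWhile ?P ?o = filter ?P ?o"
  proof -
    have "takeWhile ?P xs = filter ?P xs" if "sorted (map ((!) w) xs)" for xs
      using that
    proof (induction xs)
      case (Cons x xs)
      show ?case
      proof (cases "w ! x \<le> h")
        case False
        then have "\<forall>y\<in>set xs. \<not> w ! y \<le> h" using Cons.prems by auto
        then show ?thesis using False by (simp add: filter_empty_conv)
      qed (use Cons in simp)
    qed simp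
    then show ?thesis by (simp add: insertion_order_def)
  qed
  moreover have "?t \<le> length w"
    by (metis insertion_order_def length_sort length_takeWhile_le length_upt minus_nat.diff_0)
  ultimately show ?thesis
    using set_insertion_order[of w] by (intro exI[of _ ?t]) auto
qed

lemma map_is_slot_mask:
  "map is_slot (map (\<lambda>i. if i \<in> S then Entry (w ! i) else Slot) [0..<n]) = map (\<lambda>i. i \<notin> S) [0..<n]"
  by auto

text \<open>
  Stop the insertion just after the largest lower value \<open>h\<close>: then lower entries are present and upper
  entries are missing, so each upper entry belongs to a slot of its own.
\<close>
lemma slots_of_alternation:
  assumes "alternation w n p q"
  shows "\<exists>x \<in> set (vertical_evolution w). n \<le> count_list x Slot"
proof -
  define h where "h = Max (insert 0 ((\<lambda>i. w ! p i) ` {..<n}))"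
  obtain t where t: "t \<le> length w" "set (take t (insertion_order w)) = {i. i < length w \<and> w ! i \<le> h}"
    using ex_configuration_threshold by blast
  define S where "S = set (take t (insertion_order w))"
  have a: "p i < q i" "q i < length w" if "i < n" for i using assms that unfolding alternation_def by auto
  have ple: "w ! p i \<le> h" if "i < n" for i unfolding h_def using that by (intro Max_ge) auto
  have qgt: "h < w ! q j" if "j < n" for j
  proof -
    have "w ! p i < w ! q j" if "i < n" for i
      using assms that \<open>j < n\<close> unfolding alternation_def by blast
    then have "0 < w ! q j" "\<forall>i<n. w ! p i < w ! q j" using that by (metis not_less_zero gr0I, blast)
    then show ?thesis unfolding h_def by (subst Max_less_iff) auto
  qed
  have pl: "p i < length w" if "i < n" for i using a[OF that] by simp
  have "subseq (alternating n) (map (\<lambda>i. i \<notin> S) [0..<length w])"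
    unfolding subseq_alternating_iff
  proof (rule exI[of _ p], rule exI[of _ q], intro conjI)
    show "\<forall>j<n. \<forall>i<j. q i < p j" using assms unfolding alternation_def by blast
    show "\<forall>i<n. p i < q i \<and> q i < length (map (\<lambda>i. i \<notin> S) [0..<length w])" using a by simp
    show "\<forall>i<n. \<not> map (\<lambda>i. i \<notin> S) [0..<length w] ! p i \<and> map (\<lambda>i. i \<notin> S) [0..<length w] ! q i"
      using a pl ple qgt t(2) by (simp add: S_def) (metis not_le)
  qed
  then have "subseq (alternating n) (map is_slot (configuration w t))"
    unfolding configuration_def S_def
    by (intro subseq_alternating_merge_slots(1)) (simp only: map_is_slot_mask)
  then have "n \<le> count_list (configuration w t) Slot" by (rule count_slots_ge)
  moreover have "configuration w t \<in> set (vertical_evolution w)"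
    unfolding vertical_evolution_def set_map by (rule imageI) (use t(1) in auto)
  ultimately show ?thesis by blast
qed

text \<open>
  A configuration with many slots gives inserted entries \<open>p i\<close> and missing entries \<open>q i\<close> in
  alternating order, with each \<open>p i\<close> before each \<open>q j\<close> in the order of insertion.  Inserted and missing
  entries may share the largest inserted value \<open>v\<close>.  If \<open>k\<close> is the last index with \<open>w ! p k = v\<close>, then
  the indices below \<open>k\<close> have missing values above \<open>v\<close> and the indices above \<open>k\<close> have inserted
  values below \<open>v\<close>.  One of the two groups has at least \<open>n\<close> of the \<open>2 * n + 1\<close> indices; one more
  slot pays for a slot at the beginning of the configuration.
\<close>
lemma alternation_of_slots:
  assumes "x \<in> set (vertical_evolution w)" "2 * n + 2 \<le> count_list x Slot"
  shows "\<exists>p q. alternation w n p q"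
proof -
  define N where "N = 2 * n + 1"
  obtain t where t: "x = configuration w t" using assms(1) by (auto simp: vertical_evolution_def)
  define S where "S = set (take t (insertion_order w))"
  define c where "c = count_list x Slot - 1"
  have cn: "N \<le> c" using assms(2) by (simp add: c_def N_def)
  let ?xs = "map (\<lambda>i. if i \<in> S then Entry (w ! i) else Slot) [0..<length w]"
  have x: "x = merge_slots ?xs" by (simp only: t configuration_def S_def)
  define m where "m = count_list x Slot - (if ?xs \<noteq> [] \<and> hd ?xs = Slot then 1 else 0)"
  have m: "c \<le> m" "subseq (alternating m) (map (\<lambda>i. i \<notin> S) [0..<length w])"
    using subseq_alternating_of_slots[of ?xs]
    unfolding x[symmetric] m_def[symmetric] map_is_slot_mask by (simp_all add: c_def m_def)
  let ?bs = "map (\<lambda>i. i \<notin> S) [0..<length w]"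
  obtain p q where R: "(\<forall>i<m. p i < q i \<and> q i < length ?bs) \<and>
     (\<forall>j<m. \<forall>i<j. q i < p j) \<and> (\<forall>i<m. \<not> ?bs ! p i \<and> ?bs ! q i)"
    using m(2) unfolding subseq_alternating_iff by (elim exE)
  have pq: "p i < q i" "q i < length w" if "i < m" for i using R that by simp_all
  have qp: "q i < p j" if "i < j" "j < m" for i j using R that by simp
  have sl: "\<not> ?bs ! p i" "?bs ! q i" if "i < m" for i using R that by blast+
  have Nm: "N \<le> m" using cn m by simp
  have S: "p i \<in> S" "q i \<notin> S" if "i < m" for i
    using sl[OF that] pq[OF that] by simp_all
  have lex: "w ! p i < w ! q j \<or> w ! p i = w ! q j \<and> p i < q j" if "i < N" "j < N" for i j
    using inserted_before[of "p i" t w "q j"] S[of i] S[of j] pq(2)[of j] that Nm by (auto simp: S_def)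
  define v where "v = Max ((\<lambda>i. w ! p i) ` {..<N})"
  have vge: "w ! p i \<le> v" if "i < N" for i unfolding v_def using that by (intro Max_ge) auto
  have "v \<in> (\<lambda>i. w ! p i) ` {..<N}" unfolding v_def by (intro Max_in) (auto simp: N_def lessThan_empty_iff)
  then have ne: "{i. i < N \<and> w ! p i = v} \<noteq> {}" by auto
  define k where "k = Max {i. i < N \<and> w ! p i = v}"
  have k: "k < N" "w ! p k = v" using Max_in[OF _ ne] by (auto simp: k_def)
  have after: "w ! p i < v" if "k < i" "i < N" for i
  proof -
    have "w ! p i \<noteq> v"
    proof
      assume "w ! p i = v"
      then have "i \<le> k" using that unfolding k_def by (intro Max_ge) auto
      then show False using that by simp
    qed
    then show ?thesis using vge[of i] that by simp
  qed
  have before: "v < w ! q j" if "j < k" for j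
    using lex[of k j] k qp[of j k] that Nm by auto
  have qge: "v \<le> w ! q j" if "j < N" for j using lex[of k j] k that by auto
  show ?thesis
  proof (cases "n \<le> k")
    case True
    have "alternation w n p q"
      unfolding alternation_def
    proof (intro conjI allI impI)
      fix i j assume "i < n" "j < n"
      then show "w ! p i < w ! q j" using vge[of i] before[of j] True k by simp
    qed (use pq qp True k Nm in auto)
    then show ?thesis by (intro exI)
  next
    case False
    have "alternation w n (\<lambda>i. p (k + 1 + i)) (\<lambda>i. q (k + 1 + i))"
      unfolding alternation_def
    proof (intro conjI allI impI)
      fix i j assume "i < n" "j < n"
      then show "w ! p (k + 1 + i) < w ! q (k + 1 + j)"
        using after[of "k + 1 + i"] qge[of "k + 1 + j"] False k by (simp add: N_def)
    qed (use pq qp False k Nm in \<open>auto simp: N_def\<close>)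
    then show ?thesis by (intro exI)
  qed
qed

section \<open>Long alternations in every class\<close>

text \<open>
  The \<open>j\<close>-th entry, from the left, of a cell of kind \<open>B\<close> filled with \<open>n\<close> entries.
\<close>
definition rank :: "cell \<Rightarrow> nat \<Rightarrow> nat \<Rightarrow> nat" where
  "rank B n j = (case B of Increasing \<Rightarrow> j + 1 | Decreasing \<Rightarrow> n - j | _ \<Rightarrow> 1)"

definition height :: "cell \<Rightarrow> nat \<Rightarrow> nat" where
  "height B n = (if B = Constant then 1 else n)"

lemma cell_rel_rank:
  assumes "B \<in> monotone_cells" "i < j" "j < n"
  shows "cell_rel B (rank B n i) (rank B n j)"
  using assms by (auto simp: monotone_cells_def rank_def cell_rel_def)

lemma rank_image:
  assumes "B \<in> monotone_cells" "0 < n"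
  shows "rank B n ` {..<n} = {1..height B n}"
proof -
  consider "B = Increasing" | "B = Decreasing" | "B = Constant"
    using assms(1) by (auto simp: monotone_cells_def)
  then show ?thesis
  proof cases
    case 1
    then show ?thesis
      by (simp add: rank_def height_def image_Suc_lessThan)
  next
    case 2
    have "x \<in> (\<lambda>j. n - j) ` {..<n}" if "x \<in> {1..n}" for x
      using that by (intro image_eqI[of _ _ "n - x"]) auto
    then show ?thesis using 2 by (auto simp: rank_def height_def)
  next
    case 3
    then show ?thesis using assms(2) by (auto simp: rank_def height_def)
  qed
qed

lemma rank_bounds:
  assumes "B \<in> monotone_cells" "j < n"
  shows "1 \<le> rank B n j" "rank B n j \<le> height B n"
proof -
  have "rank B n j \<in> {1..height B n}" using rank_image[of B n] assms by fastforce
  then show "1 \<le> rank B n j" "rank B n j \<le> height B n" by auto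
qed

text \<open>
  An increasing run \<open>1, \<dots>, l\<close> in the left column, followed by a right column in which a lower cell of
  kind \<open>A\<close> and an upper cell of kind \<open>B\<close> alternate.  The case \<open>l = 0\<close> has no left column and serves
  the classes \<open>V\<close>.
\<close>
definition pattern_letter :: "nat \<Rightarrow> nat \<Rightarrow> cell \<Rightarrow> cell \<Rightarrow> nat \<Rightarrow> nat" where
  "pattern_letter n l A B i =
     (if i < l then i + 1
      else if even (i - l) then rank A n ((i - l) div 2)
      else height A n + rank B n ((i - l) div 2))"

definition pattern :: "nat \<Rightarrow> nat \<Rightarrow> cell \<Rightarrow> cell \<Rightarrow> nat list" where
  "pattern n l A B = map (pattern_letter n l A B) [0..<l + 2 * n]"

lemma pattern_props:
  assumes A: "A \<in> monotone_cells" and B: "B \<in> monotone_cells" and n: "0 < n" and l: "l \<le> height A n"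
  defines "s \<equiv> pattern n l A B"
  shows "cayley s" "height A n \<le> max_value s" "increasing_prefix (height A n) l s"
    "two_layered A B (height A n) l s"
    "alternation s n (\<lambda>i. l + 2 * i) (\<lambda>i. l + 2 * i + 1)"
proof -
  let ?h = "height A n" and ?f = "pattern_letter n l A B"
  have len: "length s = l + 2 * n" by (simp add: s_def pattern_def)
  have nth: "s ! i = ?f i" if "i < l + 2 * n" for i
    using that by (simp add: s_def pattern_def)
  have bot: "?f (l + 2 * j) = rank A n j" and top: "?f (l + 2 * j + 1) = ?h + rank B n j" for j
    by (simp_all add: pattern_letter_def)
  have halves: "(i - l) div 2 < n" if "i < l + 2 * n" for i using that n by linarith
  have low: "?f i \<le> ?h \<longleftrightarrow> i < l \<or> even (i - l)" if "i < l + 2 * n" for i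
    using rank_bounds[OF A halves[OF that]] rank_bounds[OF B halves[OF that]] l
    by (auto simp: pattern_letter_def)
  have "set s = {1..?h + height B n}"
  proof
    show "set s \<subseteq> {1..?h + height B n}"
    proof
      fix x assume "x \<in> set s"
      then obtain i where i: "i < l + 2 * n" "x = ?f i" by (auto simp: s_def pattern_def)
      then show "x \<in> {1..?h + height B n}"
        using rank_bounds[OF A halves[OF i(1)]] rank_bounds[OF B halves[OF i(1)]] l
        by (auto simp: pattern_letter_def)
    qed
    show "{1..?h + height B n} \<subseteq> set s"
    proof
      fix x assume x: "x \<in> {1..?h + height B n}"
      show "x \<in> set s"
      proof (cases "x \<le> ?h")
        case True
        then have "x \<in> rank A n ` {..<n}" unfolding rank_image[OF A n] using x by simp
        then obtain j where j: "j < n" "x = rank A n j" by auto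
        then have "x = s ! (l + 2 * j)" using nth[of "l + 2 * j"] bot by simp
        then show ?thesis using j(1) len by simp
      next
        case False
        then have "x - ?h \<in> rank B n ` {..<n}" unfolding rank_image[OF B n] using x by auto
        then obtain j where j: "j < n" "x - ?h = rank B n j" by auto
        then have "x = s ! (l + 2 * j + 1)" using nth[of "l + 2 * j + 1"] top[of j] False by simp
        then show ?thesis using j(1) len by simp
      qed
    qed
  qed
  then show s: "cayley s" by (rule cayleyI)
  have "?h \<in> {1..?h + height B n}" using n by (simp add: height_def Suc_leI)
  then show "?h \<le> max_value s" using \<open>set s = _\<close> le_max_value by blast
  show "increasing_prefix ?h l s"
    unfolding increasing_prefix_def using len nth l by (simp add: pattern_letter_def)
  show "alternation s n (\<lambda>i. l + 2 * i) (\<lambda>i. l + 2 * i + 1)"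
    unfolding alternation_def
  proof (intro conjI allI impI)
    fix i j assume ij: "i < n" "j < n"
    have "s ! (l + 2 * i) = rank A n i" "s ! (l + 2 * j + 1) = ?h + rank B n j"
      using ij nth[of "l + 2 * i"] nth[of "l + 2 * j + 1"] bot top[of j] by simp_all
    then show "s ! (l + 2 * i) < s ! (l + 2 * j + 1)"
      using rank_bounds[OF A ij(1)] rank_bounds[OF B ij(2)] by simp
  qed (use len in auto)
  show "two_layered A B ?h l s"
    unfolding two_layered_def
  proof (intro allI impI)
    fix i j assume "j < length s" and ij: "i < j" "l \<le> i"
    then have lt: "j < l + 2 * n" "i < l + 2 * n" using len by auto
    have low': "s ! i \<le> ?h \<longleftrightarrow> even (i - l)" "s ! j \<le> ?h \<longleftrightarrow> even (j - l)"
      using low[OF lt(1)] low[OF lt(2)] nth lt ij by auto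
    have "(i - l) div 2 < (j - l) div 2" if "even (i - l) = even (j - l)"
    proof -
      have "i - l < j - l" using ij by simp
      then show ?thesis using that by presburger
    qed
    then have "cell_rel A (rank A n ((i - l) div 2)) (rank A n ((j - l) div 2)) \<and>
        cell_rel B (rank B n ((i - l) div 2)) (rank B n ((j - l) div 2))"
      if "even (i - l) = even (j - l)"
      using that cell_rel_rank[OF A] cell_rel_rank[OF B] halves[OF lt(1)] by blast
    moreover have "cell_rel B (?h + x) (?h + y)" if "cell_rel B x y" for x y
      using that by (simp add: cell_rel_def split: cell.splits)
    ultimately show "(s ! i \<le> ?h \<and> s ! j \<le> ?h \<longrightarrow> cell_rel A (s ! i) (s ! j)) \<and>
        (?h < s ! i \<and> ?h < s ! j \<longrightarrow> cell_rel B (s ! i) (s ! j))"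
      using low' nth[OF lt(1)] nth[OF lt(2)] ij by (auto simp: pattern_letter_def not_le[symmetric])
  qed
qed

lemma ex_alternation_in_class:
  assumes "A \<in> monotone_cells" "B \<in> monotone_cells" "0 < n"
  shows "\<exists>s \<in> alternating_class A B. \<exists>p q. alternation s n p q"
proof -
  have Z: "A \<noteq> Zero" "B \<noteq> Zero" using assms by (auto simp: monotone_cells_def)
  define l where "l = (if A = Constant then 0 else n)"
  have "l \<le> height A n" by (simp add: l_def height_def)
  note props = pattern_props[OF assms this]
  have "pattern n l A B \<in> alternating_class A B"
  proof (cases "A = Constant")
    case True
    then have "pattern n l A B \<in> V_class A B"
      using props unfolding V_class_iff[OF Z] by (auto simp: l_def)
    then show ?thesis using True by (simp add: alternating_class_def)
  next
    case False
    have "pattern n l A B \<in> G_class A B"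
      using props(1-4) unfolding G_class_iff[OF Z] by blast
    then show ?thesis using False by (simp add: alternating_class_def)
  qed
  then show ?thesis using props(5) by (intro bexI exI)
qed

section \<open>Uniform alternations by Ramsey's theorem\<close>

definition uniform :: "nat list \<Rightarrow> nat \<Rightarrow> cell \<Rightarrow> cell \<Rightarrow> (nat \<Rightarrow> nat) \<Rightarrow> (nat \<Rightarrow> nat) \<Rightarrow> bool" where
  "uniform w n A B p q \<longleftrightarrow> (\<forall>j<n. \<forall>i<j. cell_rel A (w ! p i) (w ! p j) \<and> cell_rel B (w ! q i) (w ! q j))"

definition comparison :: "nat \<Rightarrow> nat \<Rightarrow> cell" where
  "comparison x y = (if x < y then Increasing else if y < x then Decreasing else Constant)"

lemma cell_rel_comparison: "cell_rel (comparison x y) x y"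
  by (simp add: comparison_def cell_rel_def)

definition colour :: "cell \<Rightarrow> nat" where
  "colour A = (case A of Increasing \<Rightarrow> 0 | Decreasing \<Rightarrow> 1 | Constant \<Rightarrow> 2 | Zero \<Rightarrow> 3)"

lemma colour_inj: "colour A = colour B \<Longrightarrow> A = B"
  by (simp add: colour_def split: cell.splits)

lemma colour_comparison: "colour (comparison x y) < 3"
  by (simp add: comparison_def colour_def)

lemma pair_colour_inj:
  fixes a b c d :: nat
  assumes "3 * a + b = 3 * c + d" "b < 3" "d < 3"
  shows "a = c \<and> b = d"
  using assms by presburger

text \<open>
  Colour a pair of indices by how the lower entries compare and how the upper entries compare.  There
  are nine colours, and a homogeneous set of indices is a uniform alternation.
\<close>
lemma ex_uniform_alternation:
  "\<exists>N. \<forall>w p q. alternation w N p q \<longrightarrow>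
     (\<exists>A\<in>monotone_cells. \<exists>B\<in>monotone_cells. \<exists>p q. alternation w n p q \<and> uniform w n A B p q)"
proof -
  (* At least two indices are needed to read off the colour of a homogeneous set. *)
  define m where "m = max n 2"
  obtain N where N: "partn_lst {..<N::nat} (replicate 9 m) 2" using ramsey_full by blast
  have "\<exists>A\<in>monotone_cells. \<exists>B\<in>monotone_cells. \<exists>p q. alternation w n p q \<and> uniform w n A B p q"
    if alt: "alternation w N p q" for w p q
  proof -
    define col where "col i j = 3 * colour (comparison (w ! p i) (w ! p j)) + colour (comparison (w ! q i) (w ! q j))" for i j
    define F where "F e = col (Min e) (Max e)" for e :: "nat set"
    have "col i j < 9" for i j
      using colour_comparison[of "w ! p i" "w ! p j"] colour_comparison[of "w ! q i" "w ! q j"]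
      by (simp add: col_def)
    then have "F \<in> nsets {..<N} 2 \<rightarrow> {..<9}" by (simp add: F_def)
    from partn_lstE[OF N this] obtain c H where c: "c < 9"
      and H: "H \<in> nsets {..<N} m" and hom: "F ` nsets H 2 \<subseteq> {c}"
      by (metis length_replicate nth_replicate)
    have Hfin: "finite H" "card H = m" "H \<subseteq> {..<N}" using H by (auto simp: nsets_def)
    obtain e where e: "bij_betw e {..<m} H" "strict_mono_on {..<m} e"
      using ex_bij_betw_strict_mono_card[OF Hfin(1)] Hfin(2) by metis
    have eH: "e i \<in> H" if "i < m" for i using e(1) that by (auto simp: bij_betw_def)
    have emono: "e i < e j" if "i < j" "j < m" for i j
      using e(2) that by (auto simp: strict_mono_on_def)
    have colc: "col (e i) (e j) = c" if "i < j" "j < m" for i j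
    proof -
      have "{e i, e j} \<in> nsets H 2" using eH[of i] eH[of j] emono[OF that] that by simp
      then have "F {e i, e j} = c" using hom by blast
      then show ?thesis using emono[OF that] by (simp add: F_def min_def max_def)
    qed
    define A B where "A = comparison (w ! p (e 0)) (w ! p (e 1))" and "B = comparison (w ! q (e 0)) (w ! q (e 1))"
    have "A \<in> monotone_cells" "B \<in> monotone_cells"
      by (auto simp: A_def B_def comparison_def monotone_cells_def)
    moreover have "alternation w m (p \<circ> e) (q \<circ> e)"
      using alternation_subsequence[OF alt] eH Hfin(3) emono by blast
    then have "alternation w n (p \<circ> e) (q \<circ> e)" by (rule alternation_mono) (simp add: m_def)
    moreover have "uniform w n A B (p \<circ> e) (q \<circ> e)"
      unfolding uniform_def
    proof (intro allI impI)
      fix i j assume ij: "j < n" "i < j"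
      have "col (e i) (e j) = col (e 0) (e 1)" using colc[of i j] colc[of 0 1] ij by (simp add: m_def)
      then have "comparison (w ! p (e i)) (w ! p (e j)) = A \<and> comparison (w ! q (e i)) (w ! q (e j)) = B"
        unfolding col_def A_def B_def using pair_colour_inj colour_comparison colour_inj by metis
      then show "cell_rel A (w ! (p \<circ> e) i) (w ! (p \<circ> e) j) \<and> cell_rel B (w ! (q \<circ> e) i) (w ! (q \<circ> e) j)"
        using cell_rel_comparison by (metis comp_apply)
    qed
    ultimately show ?thesis by (intro bexI exI conjI)
  qed
  then show ?thesis by (intro exI allI impI)
qed

section \<open>Embedding the members of a class into a uniform alternation\<close>

lemma cell_rel_less_iff:
  assumes "cell_rel B x y" "cell_rel B u v"
  shows "x < y \<longleftrightarrow> u < v" "y < x \<longleftrightarrow> v < u"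
  using assms by (cases B; simp add: cell_rel_def)+

text \<open>
  The \<open>i\<close>-th letter of the pattern is taken from the \<open>i\<close>-th pair of the alternation: its lower entry
  if the letter is in the bottom cell and its upper entry otherwise.
\<close>
lemma contains_V_pattern:
  assumes "s \<in> V_class Constant B" "B \<in> monotone_cells" "length s \<le> n"
    and "alternation w n p q" "uniform w n Constant B p q"
  shows "contains w s"
proof -
  have BZ: "B \<noteq> Zero" using assms(2) by (auto simp: monotone_cells_def)
  obtain h where s: "cayley s" and lay: "two_layered Constant B h 0 s"
    using assms(1) unfolding V_class_iff[OF cell.distinct(11) BZ] by (elim conjE exE)
  define f where "f i = (if s ! i \<le> h then p i else q i)" for i
  have pq: "p i < q i" "q i < length w" if "i < length s" for i
    using assms(3,4) that unfolding alternation_def by auto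
  have less: "w ! p i < w ! q j" if "i < length s" "j < length s" for i j
    using assms(3,4) that unfolding alternation_def by auto
  have mono: "f i < f j" if "i < j" "j < length s" for i j
    using alternation_order[OF assms(4), of j i] assms(3) that by (simp add: f_def)
  have iso: "(w ! f i < w ! f j \<longleftrightarrow> s ! i < s ! j) \<and> (w ! f j < w ! f i \<longleftrightarrow> s ! j < s ! i)"
    if ij: "i < j" "j < length s" for i j
  proof -
    have i: "i < length s" using ij by simp
    have u: "cell_rel Constant (w ! p i) (w ! p j)" "cell_rel B (w ! q i) (w ! q j)"
      using assms(3,5) ij unfolding uniform_def by auto
    have l: "s ! i \<le> h \<and> s ! j \<le> h \<Longrightarrow> cell_rel Constant (s ! i) (s ! j)"
      "h < s ! i \<and> h < s ! j \<Longrightarrow> cell_rel B (s ! i) (s ! j)"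
      using lay ij unfolding two_layered_def by auto
    show ?thesis
      using u(1) l cell_rel_less_iff[OF u(2)] less[OF i ij(2)] less[OF ij(2) i]
      by (cases "s ! i \<le> h"; cases "s ! j \<le> h") (simp_all add: f_def cell_rel_def)
  qed
  have "w ! f i < w ! f j \<longleftrightarrow> s ! i < s ! j" if "i < length s" "j < length s" for i j
    using iso[of i j] iso[of j i] that by (cases i j rule: linorder_cases) auto
  moreover have "f i < length w" if "i < length s" for i
    using pq[OF that] by (simp add: f_def)
  ultimately show ?thesis
    unfolding contains_iff_embedding[OF s]
    using mono by (intro exI[of _ f]) (simp add: strict_mono_on_def)
qed

lemma first_occ_props:
  assumes "v \<in> set w"
  shows "first_occ w v < length w" "w ! first_occ w v = v"
  using assms LeastI_ex[of "\<lambda>i. i < length w \<and> w ! i = v"]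
  unfolding first_occ_def in_set_conv_nth by auto

lemma first_occ_le: "i < length w \<Longrightarrow> first_occ w (w ! i) \<le> i"
  unfolding first_occ_def by (rule Least_le) simp

lemma rgf_first_occ_less:
  assumes "rgf w" "u \<in> set w" "v \<in> set w" "u < v"
  shows "first_occ w u < first_occ w v"
  using assms cayley_pos[of w u] unfolding rgf_def by (simp add: Suc_leI)

lemma cayley_le_length:
  assumes "cayley s"
  shows "max_value s \<le> length s"
  using card_length[of s] assms by (simp add: cayley_def)

text \<open>
  A bottom value \<open>u\<close> of the pattern is sent to the value \<open>phi u\<close> of a lower entry of the alternation.
  Only lower entries whose index is a positive multiple of a large number \<open>M\<close> are used: \<open>u\<close> is assigned the
  index \<open>M * rho u\<close>, where \<open>rho\<close> numbers the bottom values in the order in which they would appear in the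
  bottom right cell, from left to right.  The gaps of length \<open>M\<close> leave room for any number of upper
  entries between two consecutive bottom entries of the pattern, including none.

  A letter of the right column at position \<open>i\<close> goes to the lower entry of index \<open>k i = M * R i\<close> if it is
  a bottom letter and to the upper entry of index \<open>k i = M * R i + i\<close> otherwise, where \<open>R i\<close> is the number
  of the last bottom letter of the right column up to \<open>i\<close> (or 0 before the first).  A letter of the left
  column goes to the first occurrence of its value \<open>phi u\<close>.  Since the word is a restricted growth
  function, these first occurrences are in increasing order and precede the first upper entry, which has
  a larger value.
\<close>
lemma contains_G_pattern:
  assumes "rgf w" "s \<in> G_class A B" "A \<in> {Increasing, Decreasing}" "B \<in> monotone_cells"
    and n: "(length s + 1) * (length s + 1) \<le> n"
    and alt: "alternation w n p q" "uniform w n A B p q"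
  shows "contains w s"
proof -
  have Z: "A \<noteq> Zero" "B \<noteq> Zero" using assms(3,4) by (auto simp: monotone_cells_def)
  obtain c h where s: "cayley s" and hm: "h \<le> max_value s" and pre: "increasing_prefix h c s"
    and lay: "two_layered A B h c s"
    using assms(2) unfolding G_class_iff[OF Z] by (elim conjE exE)
  define M where "M = length s + 1"
  have hM: "h < M" using hm cayley_le_length[OF s] by (simp add: M_def)
  define rho where "rho u = (if A = Increasing then u else h + 1 - u)" for u
  have rho: "1 \<le> rho u" "rho u \<le> h" if "1 \<le> u" "u \<le> h" for u
    using that by (auto simp: rho_def)
  have spos: "1 \<le> s ! i" if "i < length s" for i using cayley_pos[OF s] that by (simp add: Suc_leI)
  (* Along the bottom right cell rho increases, so the maximum is attained at the last bottom letter. *)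
  define R where "R i = Max (insert 0 ((\<lambda>j. rho (s ! j)) ` {j. c \<le> j \<and> j \<le> i \<and> s ! j \<le> h}))" for i
  define k where "k i = M * R i + (if s ! i \<le> h then 0 else i)" for i
  have fin: "finite (insert 0 ((\<lambda>j. rho (s ! j)) ` {j. c \<le> j \<and> j \<le> i \<and> s ! j \<le> h}))" for i
    by (auto intro: finite_subset[of _ "{..i}"])
  have Rmono: "R i \<le> R j" if "i \<le> j" for i j
    unfolding R_def using that by (intro Max_mono fin) auto
  have Rge: "rho (s ! j) \<le> R i" if "c \<le> j" "j \<le> i" "s ! j \<le> h" for i j
    unfolding R_def using that by (intro Max_ge fin) auto
  have rho_incr: "rho (s ! i) < rho (s ! j)"
    if "c \<le> i" "i < j" "j < length s" "s ! i \<le> h" "s ! j \<le> h" for i j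
  proof -
    have "cell_rel A (s ! i) (s ! j)" using lay that unfolding two_layered_def by blast
    then show ?thesis using assms(3) that by (auto simp: rho_def cell_rel_def)
  qed
  have R_le: "R i \<le> x" if "\<And>j. \<lbrakk>c \<le> j; j \<le> i; s ! j \<le> h\<rbrakk> \<Longrightarrow> rho (s ! j) \<le> x" for i x
    unfolding R_def using that by (subst Max_le_iff[OF fin]) auto
  have R_less: "R i < x" if "0 < x" "\<And>j. \<lbrakk>c \<le> j; j \<le> i; s ! j \<le> h\<rbrakk> \<Longrightarrow> rho (s ! j) < x" for i x
    unfolding R_def using that by (subst Max_less_iff[OF fin]) auto
  have Rle: "R i \<le> h" if "i < length s" for i
    using that rho(2) spos by (intro R_le) auto
  have Rbot: "R i = rho (s ! i)" if "c \<le> i" "i < length s" "s ! i \<le> h" for i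
  proof (rule antisym)
    show "R i \<le> rho (s ! i)"
    proof (rule R_le)
      fix j assume "c \<le> j" "j \<le> i" "s ! j \<le> h"
      then show "rho (s ! j) \<le> rho (s ! i)"
        using rho_incr[of j i] that by (cases "j = i") auto
    qed
    show "rho (s ! i) \<le> R i" using Rge that by simp
  qed
  have Rtop: "R i < R j" if "c \<le> i" "i < j" "j < length s" "s ! j \<le> h" for i j
  proof -
    have "R i < rho (s ! j)"
    proof (rule R_less)
      show "0 < rho (s ! j)" using rho(1)[of "s ! j"] spos[of j] that by simp
      fix l assume "c \<le> l" "l \<le> i" "s ! l \<le> h"
      then show "rho (s ! l) < rho (s ! j)" using rho_incr[of l j] that by simp
    qed
    then show ?thesis using Rbot[of j] that by simp
  qed
  (* Both rho and the positions stay below M, so all indices used are below M * M. *)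
  have bound: "M * r + i < n" if "r \<le> h" "i < M" for r i
  proof -
    have "M * r + i < M * (r + 1)" using that by simp
    also have "\<dots> \<le> M * M" using that hM by (intro mult_le_mono2) simp
    also have "\<dots> \<le> n" using n by (simp add: M_def)
    finally show ?thesis .
  qed
  have kn: "k i < n" if "i < length s" for i
    unfolding k_def using bound[OF Rle[OF that], of i] bound[OF Rle[OF that], of 0] that by (simp add: M_def)
  have n0: "0 < n" using n by simp
  define phi where "phi u = w ! p (M * rho u)" for u
  have plen: "p l < length w" "q l < length w" "p l < q l" if "l < n" for l
    using alt(1) that unfolding alternation_def by (auto intro: less_trans)
  have pq: "w ! p l < w ! q l'" if "l < n" "l' < n" for l l'
    using alt(1) that unfolding alternation_def by blast
  have Mrho: "M * rho u < n" if "1 \<le> u" "u \<le> h" for u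
    using bound[OF rho(2)[OF that], of 0] by (simp add: M_def)
  have phi_mono: "phi u < phi v" if "1 \<le> u" "u < v" "v \<le> h" for u v
  proof (cases "A = Increasing")
    case True
    have "M * rho u < M * rho v"
      using that True hM by (intro mult_strict_left_mono) (simp_all add: rho_def)
    moreover have "M * rho v < n" using Mrho[of v] that by simp
    ultimately have "cell_rel A (w ! p (M * rho u)) (w ! p (M * rho v))"
      using alt(2) unfolding uniform_def by blast
    then show ?thesis using True by (simp add: phi_def cell_rel_def)
  next
    case False
    have "M * rho v < M * rho u"
      using that False hM by (intro mult_strict_left_mono) (simp_all add: rho_def)
    moreover have "M * rho u < n" using Mrho[of u] that by simp
    ultimately have "cell_rel A (w ! p (M * rho v)) (w ! p (M * rho u))"
      using alt(2) unfolding uniform_def by blast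
    then show ?thesis using False assms(3) by (auto simp: phi_def cell_rel_def)
  qed
  have phi_iff: "phi u < phi v \<longleftrightarrow> u < v" if "1 \<le> u" "u \<le> h" "1 \<le> v" "v \<le> h" for u v
    using phi_mono[of u v] phi_mono[of v u] that by (cases u v rule: linorder_cases) auto
  have phi_set: "phi u \<in> set w" if "1 \<le> u" "u \<le> h" for u
    using plen(1)[OF Mrho[OF that]] by (simp add: phi_def)
  have phi_q: "phi u < w ! q l" if "1 \<le> u" "u \<le> h" "l < n" for u l
    using pq[OF Mrho] that by (simp add: phi_def)
  define f where "f i = (if i < c then first_occ w (phi (s ! i)) else if s ! i \<le> h then p (k i) else q (k i))" for i
  have cs: "c \<le> length s" "\<And>i. i < c \<Longrightarrow> s ! i \<le> h" "\<And>i j. j < c \<Longrightarrow> i < j \<Longrightarrow> s ! i < s ! j"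
    using pre unfolding increasing_prefix_def by auto
  have fval: "w ! f i = (if s ! i \<le> h then phi (s ! i) else w ! q (k i))" if "i < length s" for i
    using first_occ_props(2)[OF phi_set, of "s ! i"] spos[OF that] cs(2)[of i] Rbot[of i] that
    by (auto simp: f_def phi_def k_def)
  have flen: "f i < length w" if "i < length s" for i
    using first_occ_props(1)[OF phi_set, of "s ! i"] spos[OF that] cs(2)[of i] plen[OF kn[OF that]] that
    by (auto simp: f_def)
  have left: "first_occ w (phi u) < q 0" if "1 \<le> u" "u \<le> h" for u
  proof -
    have "first_occ w (phi u) < first_occ w (w ! q 0)"
      using rgf_first_occ_less[OF assms(1) phi_set[OF that] _ phi_q[OF that n0]] plen[OF n0] by simp
    also have "\<dots> \<le> q 0" using first_occ_le plen[OF n0] by blast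
    finally show ?thesis .
  qed
  (* Since rho is positive, q 0 precedes every bottom letter of the right column and so separates the columns. *)
  have right: "q 0 \<le> f i" if "c \<le> i" "i < length s" for i
  proof (cases "s ! i \<le> h")
    case True
    then have "0 < k i" using Rbot[OF that True] rho(1)[of "s ! i"] spos[OF that(2)]
      by (auto simp: k_def M_def)
    then have "q 0 < p (k i)" using alternation_order(6)[OF alt(1) kn[OF that(2)], of 0] by simp
    then show ?thesis using that True by (simp add: f_def)
  next
    case False
    then show ?thesis
      using that alternation_order(2)[OF alt(1) kn[OF that(2)], of 0] by (simp add: f_def)
  qed
  have mono: "f i < f j" if ij: "i < j" "j < length s" for i j
  proof -
    consider "j < c" | "i < c" "c \<le> j" | "c \<le> i" by linarith
    then show ?thesis
    proof cases
      case 1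
      then have "s ! i < s ! j" "s ! j \<le> h" "1 \<le> s ! i" using cs ij spos[of i] by auto
      then show ?thesis
        using rgf_first_occ_less[OF assms(1) phi_set phi_set phi_mono] 1 ij by (simp add: f_def)
    next
      case 2
      then show ?thesis
        using left[of "s ! i"] right[of j] cs(2)[of i] spos[of i] ij by (simp add: f_def)
    next
      case 3
      have iM: "i < M" "i < length s" using ij by (simp_all add: M_def)
      note ord = alternation_order[OF alt(1) kn[OF ij(2)], of "k i"]
      have Rij: "R i \<le> R j" using Rmono ij by simp
      have top_bot: "k i < k j" if "R i < R j"
      proof -
        have "M * R i + (if s ! i \<le> h then 0 else i) < M * (R i + 1)" using iM by simp
        also have "\<dots> \<le> M * R j" using that by (intro mult_le_mono2) simp
        finally show ?thesis by (simp add: k_def)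
      qed
      show ?thesis
      proof (cases "s ! i \<le> h"; cases "s ! j \<le> h")
        assume a: "s ! i \<le> h" "s ! j \<le> h"
        then have "R i < R j" using Rtop 3 ij by simp
        then show ?thesis using top_bot ord a 3 ij by (simp add: f_def)
      next
        assume a: "s ! i \<le> h" "\<not> s ! j \<le> h"
        then have "k i \<le> k j" using Rij by (simp add: k_def trans_le_add1)
        then show ?thesis using ord a 3 ij by (simp add: f_def)
      next
        assume a: "\<not> s ! i \<le> h" "s ! j \<le> h"
        then have "R i < R j" using Rtop 3 ij by simp
        then show ?thesis using top_bot ord a 3 ij by (simp add: f_def)
      next
        assume a: "\<not> s ! i \<le> h" "\<not> s ! j \<le> h"
        then have "k i < k j" using Rij ij by (simp add: k_def add_le_less_mono)
        then show ?thesis using ord a 3 ij by (simp add: f_def)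
      qed
    qed
  qed
  have iso: "(w ! f i < w ! f j \<longleftrightarrow> s ! i < s ! j) \<and> (w ! f j < w ! f i \<longleftrightarrow> s ! j < s ! i)"
    if ij: "i < j" "j < length s" for i j
  proof -
    have i: "i < length s" using ij by simp
    have bt: "phi (s ! a) < w ! q (k b)" if "s ! a \<le> h" "a < length s" "b < length s" for a b
      using phi_q[OF spos that(1) kn] that by simp
    show ?thesis
    proof (cases "s ! i \<le> h"; cases "s ! j \<le> h")
      assume a: "\<not> s ! i \<le> h" "\<not> s ! j \<le> h"
      have c: "c \<le> i" using cs(2) a by (meson not_le)
      have 1: "cell_rel B (s ! i) (s ! j)"
        using lay a c ij unfolding two_layered_def by (simp add: not_le)
      have "k i < k j" using Rmono[of i j] ij a by (simp add: k_def add_le_less_mono)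
      then have 2: "cell_rel B (w ! q (k i)) (w ! q (k j))"
        using alt(2) kn[OF ij(2)] unfolding uniform_def by blast
      show ?thesis using cell_rel_less_iff[OF 2 1] a fval[OF i] fval[OF ij(2)] by simp
    qed (use fval[OF i] fval[OF ij(2)] phi_iff spos[OF i] spos[OF ij(2)] bt[of i j] bt[of j i] i ij in auto)
  qed
  have "w ! f i < w ! f j \<longleftrightarrow> s ! i < s ! j" if "i < length s" "j < length s" for i j
    using iso[of i j] iso[of j i] that by (cases i j rule: linorder_cases) auto
  then show ?thesis
    unfolding contains_iff_embedding[OF s]
    using mono flen by (intro exI[of _ f]) (simp add: strict_mono_on_def)
qed

lemma contains_alternating_class:
  assumes "rgf w" "s \<in> alternating_class A B" "A \<in> monotone_cells" "B \<in> monotone_cells"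
    and n: "(length s + 1) * (length s + 1) \<le> n"
    and alt: "alternation w n p q" "uniform w n A B p q"
  shows "contains w s"
proof (cases "A = Constant")
  case True
  have "length s \<le> n" using n by simp
  then show ?thesis
    using contains_V_pattern[of s B n w p q] assms True by (simp add: alternating_class_def)
next
  case False
  then show ?thesis
    using contains_G_pattern[of w s A B n p q] assms
    by (auto simp: alternating_class_def monotone_cells_def)
qed

section \<open>Bounded slots and avoided classes\<close>

theorem theorem3p6:
  fixes R :: "nat list set"
  assumes "rgf_class R"
  shows "(\<exists>k::nat. k > 0 \<and> R \<subseteq> SB_V k) \<longleftrightarrow>
    (\<forall>X \<in> {G_class Increasing Increasing, G_class Increasing Constant,
           G_class Increasing Decreasing, G_class Decreasing Increasing,
           G_class Decreasing Constant, G_class Decreasing Decreasing,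
           V_class Constant Increasing, V_class Constant Constant,
           V_class Constant Decreasing}.
       \<exists>\<sigma> \<in> X. \<forall>\<pi> \<in> R. avoids \<pi> \<sigma>)" (is "?bounded \<longleftrightarrow> ?avoid")
proof -
  have "?avoid \<longleftrightarrow> (\<forall>A\<in>monotone_cells. \<forall>B\<in>monotone_cells. \<exists>\<sigma>\<in>alternating_class A B. \<forall>\<pi>\<in>R. avoids \<pi> \<sigma>)"
    by (simp add: monotone_cells_def alternating_class_def conj_ac)
  also have "\<dots> \<longleftrightarrow> ?bounded"
  proof
    assume "?bounded"
    then obtain k where k: "R \<subseteq> SB_V k" by blast
    show "\<forall>A\<in>monotone_cells. \<forall>B\<in>monotone_cells. \<exists>\<sigma>\<in>alternating_class A B. \<forall>\<pi>\<in>R. avoids \<pi> \<sigma>"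
    proof (intro ballI)
      fix A B assume "A \<in> monotone_cells" "B \<in> monotone_cells"
      then obtain s p q where s: "s \<in> alternating_class A B" "alternation s (k + 1) p q"
        by (metis ex_alternation_in_class zero_less_Suc Suc_eq_plus1)
      have "avoids w s" if "w \<in> R" for w
      proof (rule ccontr)
        assume "\<not> avoids w s"
        then obtain p q where "alternation w (k + 1) p q"
          using alternation_of_contained[OF s(2) _ alternating_class_cayley[OF s(1)]]
          unfolding avoids_def by blast
        then obtain x where "x \<in> set (vertical_evolution w)" "k + 1 \<le> count_list x Slot"
          using slots_of_alternation by blast
        moreover have "w \<in> SB_V k" using k that by blast
        ultimately show False unfolding SB_V_def by fastforce
      qed
      then show "\<exists>\<sigma>\<in>alternating_class A B. \<forall>\<pi>\<in>R. avoids \<pi> \<sigma>" using s(1) by blast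
    qed
  next
    assume "\<forall>A\<in>monotone_cells. \<forall>B\<in>monotone_cells. \<exists>\<sigma>\<in>alternating_class A B. \<forall>\<pi>\<in>R. avoids \<pi> \<sigma>"
    then obtain \<sigma> where \<sigma>: "\<And>A B. \<lbrakk>A \<in> monotone_cells; B \<in> monotone_cells\<rbrakk> \<Longrightarrow>
        \<sigma> A B \<in> alternating_class A B \<and> (\<forall>\<pi>\<in>R. avoids \<pi> (\<sigma> A B))"
      by metis
    define size_bound where "size_bound A B = (length (\<sigma> A B) + 1) * (length (\<sigma> A B) + 1)" for A B
    define n where "n = (\<Sum>A\<in>monotone_cells. \<Sum>B\<in>monotone_cells. size_bound A B)"
    have fin: "finite monotone_cells" by (simp add: monotone_cells_def)
    have n: "size_bound A B \<le> n" if "A \<in> monotone_cells" "B \<in> monotone_cells" for A B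
    proof -
      have "size_bound A B \<le> (\<Sum>B\<in>monotone_cells. size_bound A B)"
        using fin that(2) by (intro member_le_sum) auto
      also have "\<dots> \<le> n"
        unfolding n_def using fin that(1) by (intro member_le_sum) auto
      finally show ?thesis .
    qed
    obtain N where N: "\<And>w p q. alternation w N p q \<Longrightarrow>
      \<exists>A\<in>monotone_cells. \<exists>B\<in>monotone_cells. \<exists>p q. alternation w n p q \<and> uniform w n A B p q"
      using ex_uniform_alternation[of n] by blast
    have "w \<in> SB_V (2 * N + 2)" if w: "w \<in> R" for w
    proof (rule ccontr)
      assume no: "w \<notin> SB_V (2 * N + 2)"
      have rgf: "rgf w" using assms w unfolding rgf_class_def rgf_avoiding_def by blast
      then obtain x where "x \<in> set (vertical_evolution w)" "2 * N + 2 \<le> count_list x Slot"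
        using no unfolding SB_V_def by fastforce
      then obtain p q where "alternation w N p q" using alternation_of_slots by blast
      then obtain A B p q where AB: "A \<in> monotone_cells" "B \<in> monotone_cells"
        and "alternation w n p q" "uniform w n A B p q"
        using N by blast
      then have "contains w (\<sigma> A B)"
        using contains_alternating_class[OF rgf, of "\<sigma> A B" A B n p q] \<sigma>[OF AB] n[OF AB]
        by (simp add: size_bound_def)
      then show False using \<sigma>[OF AB] w by (simp add: avoids_def)
    qed
    then have "R \<subseteq> SB_V (2 * N + 2)" by blast
    then show ?bounded by (intro exI[of _ "2 * N + 2"]) simp
  qed
  finally show ?thesis by blast
qed
end
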